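(* Let $f_1,\dots,f_m:\mathbb{R}^n\to\mathbb{R}$ be differentiable functions and let $f(x)=\sum_{i=1}^m f_i(x)$. Assume: (1) each $f_i$ is non-negative, i.e. $f_i(x)\ge0$ for all $x\in\mathbb{R}^n$; (2) each $f_i$ has Lipschitz continuous gradient with constant $L_i$, i.e. $\|\nabla f_i(x)-\nabla f_i(z)\|\le L_i\|x-z\|$ for all $x,z\in\mathbb{R}^n$, $i=1,\dots,m$; and there is a constant $\gamma>0$ such that for all $x\in\mathbb{R}^n$ $$f(x)-f(P(x))\le\langle\nabla f(x),x-P(x)\rangle-\frac{\gamma}{2}\|P(x)-x\|^2,$$ where $P(x)$ is the projection of $x$ onto the set of global minimizers of $f$; (3) $\min_x f(x)=0$. Let $x^{+}$ be the (random) point obtained from $x\in\mathbb{R}^n$ by one iteration of the doubly stochastic gradient algorithm (described in the context) with a stepsize $\alpha$ satisfying $$0<\alpha\le\frac{\gamma^2}{2\sum_{\ell=1}^m L_\ell\ \sum_{i=1}^m L_i^2}$$ (the denominator being $2\big(\sum_{\ell=1}^m L_\ell\big)\big(\sum_{i=1}^m L_i^2\big)$). Then $$\mathbb{E}\left[f(x^{+})\mid x\right]\le\left(1-\frac{\alpha\gamma}{mn}\right)f(x).$$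
   Context: Doubly stochastic gradient algorithm for $\min_x f(x)=\sum_{i=1}^m f_i(x)$ with stepsize $\alpha>0$: given the current iterate $x\in\mathbb{R}^n$, select one index pair $(i,j)\in\{1,\dots,m\}\times\{1,\dots,n\}$ uniformly, i.e. each with probability $p_{ij}=\frac{1}{mn}$, and set $$x_j^{+}=x_j-\alpha\,\nabla_j f_i(x),\qquad x_k^{+}=x_k\ \text{ for all } k\ne j,$$ where $\nabla_j f_i$ is the partial derivative of $f_i$ with respect to the $j$-th coordinate. Projection: $P(x)\in\arg\min_{y\in X^*}\|x-y\|$, where $X^*$ is the (nonempty) set of global minimizers of $f$. $\|\cdot\|$ is the Euclidean norm. *)

theory Defs
  imports "HOL-Probability.Probability"
begin

definition partial_deriv :: "'n::finite \<Rightarrow> (real ^ 'n \<Rightarrow> real) \<Rightarrow> real ^ 'n \<Rightarrow> real" where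
  "partial_deriv j f x = deriv (\<lambda>t. f (x + t *\<^sub>R axis j 1)) 0"

definition grad :: "(real ^ 'n::finite \<Rightarrow> real) \<Rightarrow> real ^ 'n \<Rightarrow> real ^ 'n" where
  "grad f x = (\<chi> j. partial_deriv j f x)"

text \<open>For differentiable functions \<open>grad\<close> is the gradient in the sense of the library's \<open>gderiv\<close>.\<close>

lemma gderiv_grad:
  fixes f :: "real ^ 'n::finite \<Rightarrow> real"
  assumes "f differentiable (at x)"
  shows "GDERIV f x :> grad f x"
proof -
  from assms obtain f' where f': "(f has_derivative f') (at x)"
    by (auto simp: differentiable_def)
  interpret bounded_linear f'
    using f' by (rule has_derivative_bounded_linear)
  have pd: "partial_deriv j f x = f' (axis j 1)" for j
  proof -
    have "((\<lambda>t::real. x + t *\<^sub>R axis j 1) has_derivative (\<lambda>t. t *\<^sub>R axis j 1)) (at 0)"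
      by (auto intro!: derivative_eq_intros)
    moreover have "(f has_derivative f') (at (x + 0 *\<^sub>R axis j 1))"
      using f' by simp
    ultimately have "((\<lambda>t. f (x + t *\<^sub>R axis j 1)) has_derivative (\<lambda>t. f' (t *\<^sub>R axis j 1))) (at 0)"
      by (rule has_derivative_compose)
    moreover have "(\<lambda>t. f' (t *\<^sub>R axis j 1)) = (*) (f' (axis j 1))"
      by (simp add: scaleR mult.commute fun_eq_iff)
    ultimately have "((\<lambda>t. f (x + t *\<^sub>R axis j 1)) has_field_derivative f' (axis j 1)) (at 0)"
      by (simp add: has_field_derivative_def)
    then show ?thesis
      unfolding partial_deriv_def by (rule DERIV_imp_deriv)
  qed
  have "f' h = h \<bullet> grad f x" for h
  proof -
    have "h = (\<Sum>j\<in>UNIV. (h $ j) *\<^sub>R axis j 1)"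
      using basis_expansion[of h] by (simp add: scalar_mult_eq_scaleR)
    then have "f' h = f' (\<Sum>j\<in>UNIV. (h $ j) *\<^sub>R axis j 1)"
      by simp
    also have "\<dots> = h \<bullet> grad f x"
      by (simp add: sum scaleR inner_vec_def grad_def pd)
    finally show ?thesis .
  qed
  then have "f' = (\<lambda>h. h \<bullet> grad f x)"
    by (rule ext)
  with f' show ?thesis
    by (simp add: gderiv_def)
qed

definition global_minimizers :: "('a \<Rightarrow> real) \<Rightarrow> 'a set" where
  "global_minimizers f = {x. \<forall>y. f x \<le> f y}"

text \<open>Projections onto the possibly non-convex set \<open>S\<close> need not be unique;
  \<open>P\<close> may be any selection of nearest points.\<close>

definition is_projection :: "'a::real_normed_vector set \<Rightarrow> ('a \<Rightarrow> 'a) \<Rightarrow> bool" where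
  "is_projection S P \<longleftrightarrow> (\<forall>x. is_arg_min (\<lambda>y. norm (x - y)) (\<lambda>y. y \<in> S) (P x))"

definition coord_grad_update ::
  "real \<Rightarrow> (real ^ 'n::finite \<Rightarrow> real) \<Rightarrow> 'n \<Rightarrow> real ^ 'n \<Rightarrow> real ^ 'n" where
  "coord_grad_update \<alpha> f j x = (\<chi> k. if k = j then x $ j - \<alpha> * partial_deriv j f x else x $ k)"

text \<open>The law of the next iterate, given the current iterate \<open>x\<close>.\<close>

definition doubly_stochastic_step ::
  "nat \<Rightarrow> (nat \<Rightarrow> real ^ 'n::finite \<Rightarrow> real) \<Rightarrow> real \<Rightarrow> real ^ 'n \<Rightarrow> (real ^ 'n) pmf" where
  "doubly_stochastic_step m fs \<alpha> x =
     map_pmf (\<lambda>(i, j). coord_grad_update \<alpha> (fs i) j x) (pmf_of_set ({1..m} \<times> (UNIV :: 'n set)))"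

end

theory Submission
  imports Defs
begin

text \<open>
  Write \<open>L\<close> for the sum of the Lipschitz constants. Then \<open>\<nabla>f\<close> is \<open>L\<close>-Lipschitz, so the quadratic
  upper bound for \<open>f\<close> (\<open>quadratic_upper_bound\<close>) applies to each possible step, and averaging over
  the pairs \<open>(i, j)\<close> assembles the partial derivatives into full inner products and norms:
  \<open>E f (x\<^sup>+) \<le> f x - \<alpha> / (m n) \<parallel>\<nabla>f x\<parallel>\<^sup>2 + L \<alpha>\<^sup>2 / (2 m n) (\<Sum>i. \<parallel>\<nabla>f\<^sub>i x\<parallel>\<^sup>2)\<close> (\<open>expected_decrease\<close>).

  The noise term is controlled by interpolation: as the \<open>f\<^sub>i\<close> are non-negative and their sum vanishes
  at \<open>P x\<close>, the point \<open>P x\<close> minimizes every single \<open>f\<^sub>i\<close>. Hence \<open>\<nabla>f\<^sub>i (P x) = 0\<close> and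
  \<open>\<parallel>\<nabla>f\<^sub>i x\<parallel> \<le> L\<^sub>i d\<close> with \<open>d = \<parallel>x - P x\<parallel>\<close>. The stepsize bound turns the noise term into at most
  \<open>\<alpha> / (m n)\<close> times \<open>(\<gamma> d / 2)\<^sup>2\<close>, and the growth condition guarantees
  \<open>\<gamma> f x \<le> \<parallel>\<nabla>f x\<parallel>\<^sup>2 - (\<gamma> d / 2)\<^sup>2\<close> (\<open>growth_imp_gradient_bound\<close>), which is what remains to be shown.
\<close>

section \<open>Gradients\<close>

lemma gderiv_unique:
  assumes "GDERIV f x :> a" and "GDERIV f x :> b"
  shows "a = b"
proof -
  have "(\<lambda>h. h \<bullet> a) = (\<lambda>h. h \<bullet> b)"
    using assms unfolding gderiv_def by (rule has_derivative_unique)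
  then show ?thesis
    by (simp only: fun_eq_iff vector_eq_ldot)
qed

lemma gderiv_sum:
  assumes "\<And>i. i \<in> I \<Longrightarrow> GDERIV (f i) x :> g i"
  shows "GDERIV (\<lambda>x. \<Sum>i\<in>I. f i x) x :> (\<Sum>i\<in>I. g i)"
  using assms by (auto simp: gderiv_def inner_sum_right intro: has_derivative_sum)

lemma gderiv_zero_at_minimum:
  fixes f :: "'a::real_inner \<Rightarrow> real"
  assumes "GDERIV f x :> g" and "\<And>y. f x \<le> f y"
  shows "g = 0"
proof -
  have "(\<lambda>h. h \<bullet> g) = (\<lambda>h. 0)"
    using assms unfolding gderiv_def
    by (intro has_derivative_local_min[where f = f and x = x]) auto
  then have "g \<bullet> g = 0"
    by (rule fun_cong)
  then show ?thesis
    by simp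
qed

text \<open>
  Along the segment from \<open>x\<close> to \<open>x + v\<close> the difference of the two sides is monotone: its derivative
  at time \<open>t\<close> is \<open>(G (x + t v) - G x) \<bullet> v - M t \<parallel>v\<parallel>\<^sup>2\<close>, which is non-positive by the Cauchy-Schwarz
  inequality and the Lipschitz condition.
\<close>

lemma quadratic_upper_bound:
  fixes f :: "'a::real_inner \<Rightarrow> real"
  assumes G: "\<And>y. GDERIV f y :> G y"
    and lipschitz: "\<And>y z. norm (G y - G z) \<le> M * norm (y - z)"
  shows "f (x + v) \<le> f x + G x \<bullet> v + M / 2 * (norm v)\<^sup>2"
proof -
  define \<phi> where "\<phi> t = f (x + t *\<^sub>R v) - t * (G x \<bullet> v) - M / 2 * t\<^sup>2 * (norm v)\<^sup>2" for t
  have deriv: "(\<phi> has_real_derivative (G (x + t *\<^sub>R v) - G x) \<bullet> v - M * t * (norm v)\<^sup>2) (at t)"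
    for t
  proof -
    have "((\<lambda>t. x + t *\<^sub>R v) has_derivative (\<lambda>s. s *\<^sub>R v)) (at t)"
      by (auto intro!: derivative_eq_intros)
    moreover have "(f has_derivative (\<lambda>h. h \<bullet> G (x + t *\<^sub>R v))) (at (x + t *\<^sub>R v))"
      using G by (simp add: gderiv_def)
    ultimately have
      "((\<lambda>t. f (x + t *\<^sub>R v)) has_derivative (\<lambda>s. (s *\<^sub>R v) \<bullet> G (x + t *\<^sub>R v))) (at t)"
      by (rule has_derivative_compose)
    then have "((\<lambda>t. f (x + t *\<^sub>R v)) has_real_derivative G (x + t *\<^sub>R v) \<bullet> v) (at t)"
      unfolding has_field_derivative_def
      by (rule has_derivative_eq_rhs) (simp add: fun_eq_iff inner_commute[of v] mult.commute)
    then show ?thesis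
      unfolding \<phi>_def
      by (auto intro!: derivative_eq_intros simp: inner_diff_left)
  qed
  have "\<phi> 1 \<le> \<phi> 0"
  proof (rule DERIV_nonpos_imp_nonincreasing[where f = \<phi>])
    fix t :: real assume t: "0 \<le> t" "t \<le> 1"
    have "(G (x + t *\<^sub>R v) - G x) \<bullet> v \<le> norm (G (x + t *\<^sub>R v) - G x) * norm v"
      by (rule norm_cauchy_schwarz)
    also have "\<dots> \<le> (M * norm (t *\<^sub>R v)) * norm v"
      using lipschitz[of "x + t *\<^sub>R v" x] by (intro mult_right_mono) auto
    also have "\<dots> = M * t * (norm v)\<^sup>2"
      using t by (simp add: power2_eq_square)
    finally show "\<exists>y. (\<phi> has_real_derivative y) (at t) \<and> y \<le> 0"
      using deriv[of t] by (intro exI conjI) auto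
  qed simp
  then show ?thesis
    by (simp add: \<phi>_def)
qed

section \<open>One step of the algorithm\<close>

lemma coord_grad_update_eq:
  "coord_grad_update \<alpha> f j x = x + (- \<alpha> * grad f x $ j) *\<^sub>R axis j 1"
  by (auto simp: coord_grad_update_def grad_def axis_def vec_eq_iff)

lemma expectation_doubly_stochastic_step:
  fixes fs :: "nat \<Rightarrow> real ^ 'n::finite \<Rightarrow> real" and h :: "real ^ 'n \<Rightarrow> real"
  assumes "m \<ge> 1"
  shows "measure_pmf.expectation (doubly_stochastic_step m fs \<alpha> x) h
    = (\<Sum>i=1..m. \<Sum>j\<in>UNIV. h (coord_grad_update \<alpha> (fs i) j x)) / (real m * real CARD('n))"
  using assms
  by (simp add: doubly_stochastic_step_def integral_pmf_of_set card_cartesian_product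
      sum.cartesian_product case_prod_beta)

text \<open>
  The stochastic direction is unbiased up to scaling: over all pairs \<open>(i, j)\<close> the first-order terms
  \<open>\<nabla>\<^sub>j f\<^sub>i x \<cdot> \<nabla>\<^sub>j f x\<close> add up to \<open>\<parallel>\<nabla>f x\<parallel>\<^sup>2\<close>.
\<close>

lemma expected_decrease:
  fixes m :: nat and fs :: "nat \<Rightarrow> real ^ 'n::finite \<Rightarrow> real"
  defines "f \<equiv> \<lambda>x. \<Sum>i=1..m. fs i x"
  assumes "m \<ge> 1"
    and G: "\<And>i y. i \<in> {1..m} \<Longrightarrow> GDERIV (fs i) y :> grad (fs i) y"
    and lipschitz: "\<And>i x z. i \<in> {1..m} \<Longrightarrow>
      norm (grad (fs i) x - grad (fs i) z) \<le> L i * norm (x - z)"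
  shows "measure_pmf.expectation (doubly_stochastic_step m fs \<alpha> x) f
    \<le> f x - (\<alpha> * (norm (\<Sum>i=1..m. grad (fs i) x))\<^sup>2
        - (\<Sum>i=1..m. L i) * \<alpha>\<^sup>2 / 2 * (\<Sum>i=1..m. (norm (grad (fs i) x))\<^sup>2))
        / (real m * real CARD('n))"
proof -
  define g where "g y = (\<Sum>i=1..m. grad (fs i) y)" for y
  define M where "M = (\<Sum>i=1..m. L i)"
  have gderiv: "GDERIV f y :> g y" for y
    unfolding f_def g_def by (intro gderiv_sum G)
  have g_lipschitz: "norm (g y - g z) \<le> M * norm (y - z)" for y z
  proof -
    have "norm (g y - g z) \<le> (\<Sum>i=1..m. norm (grad (fs i) y - grad (fs i) z))"
      unfolding g_def sum_subtractf[symmetric] by (rule norm_sum)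
    also have "\<dots> \<le> (\<Sum>i=1..m. L i * norm (y - z))"
      by (intro sum_mono lipschitz)
    finally show ?thesis
      by (simp add: M_def sum_distrib_right)
  qed
  have step: "f (coord_grad_update \<alpha> (fs i) j x)
      \<le> f x - \<alpha> * (grad (fs i) x $ j * g x $ j) + M * \<alpha>\<^sup>2 / 2 * (grad (fs i) x $ j)\<^sup>2" for i j
    using quadratic_upper_bound[OF gderiv g_lipschitz, of x "(- \<alpha> * grad (fs i) x $ j) *\<^sub>R axis j 1"]
    by (simp add: coord_grad_update_eq inner_axis power_mult_distrib algebra_simps)
  have norm_sq: "(norm v)\<^sup>2 = (\<Sum>j\<in>UNIV. (v $ j)\<^sup>2)" for v :: "real ^ 'n"
    unfolding power2_norm_eq_inner by (simp add: inner_vec_def power2_eq_square)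
  have first_order: "(\<Sum>i=1..m. \<Sum>j\<in>UNIV. grad (fs i) x $ j * g x $ j) = (norm (g x))\<^sup>2"
    unfolding power2_norm_eq_inner inner_vec_def
    by (subst sum.swap) (simp add: g_def sum_distrib_right[symmetric])
  have "(\<Sum>i=1..m. \<Sum>j\<in>UNIV. f (coord_grad_update \<alpha> (fs i) j x))
      \<le> (\<Sum>i=1..m. \<Sum>j\<in>(UNIV :: 'n set). f x - \<alpha> * (grad (fs i) x $ j * g x $ j)
          + M * \<alpha>\<^sup>2 / 2 * (grad (fs i) x $ j)\<^sup>2)"
    by (intro sum_mono step)
  also have "\<dots> = real m * real CARD('n) * f x - \<alpha> * (norm (g x))\<^sup>2
      + M * \<alpha>\<^sup>2 / 2 * (\<Sum>i=1..m. (norm (grad (fs i) x))\<^sup>2)"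
    by (simp add: sum.distrib sum_subtractf sum_distrib_left[symmetric] first_order norm_sq[symmetric]
        del: times_divide_eq_left One_nat_def)
  finally have total: "(\<Sum>i=1..m. \<Sum>j\<in>UNIV. f (coord_grad_update \<alpha> (fs i) j x))
      \<le> real m * real CARD('n) * f x - (\<alpha> * (norm (g x))\<^sup>2
          - M * \<alpha>\<^sup>2 / 2 * (\<Sum>i=1..m. (norm (grad (fs i) x))\<^sup>2))"
    by linarith
  define K where "K = real m * real CARD('n)"
  have "K > 0"
    using \<open>m \<ge> 1\<close> by (simp add: K_def)
  with divide_right_mono[OF total, of K] show ?thesis
    unfolding expectation_doubly_stochastic_step[OF \<open>m \<ge> 1\<close>] g_def[symmetric] M_def[symmetric]
      K_def[symmetric]
    by (simp add: diff_divide_distrib)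
qed

section \<open>Linear convergence\<close>

text \<open>
  By the Cauchy-Schwarz inequality, \<open>\<gamma> F\<close> is at most \<open>\<gamma> \<parallel>g\<parallel> \<parallel>v\<parallel> - \<gamma>\<^sup>2 / 2 \<parallel>v\<parallel>\<^sup>2\<close>, which falls short
  of the right-hand side by exactly the square \<open>(\<parallel>g\<parallel> - \<gamma> / 2 \<parallel>v\<parallel>)\<^sup>2\<close>.
\<close>

lemma growth_imp_gradient_bound:
  fixes g v :: "'a::real_inner"
  assumes "\<gamma> \<ge> 0" and "F \<le> g \<bullet> v - \<gamma> / 2 * (norm v)\<^sup>2"
  shows "\<gamma> * F \<le> (norm g)\<^sup>2 - (\<gamma> / 2 * norm v)\<^sup>2"
proof -
  have "F \<le> norm g * norm v - \<gamma> / 2 * (norm v)\<^sup>2"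
    using assms(2) norm_cauchy_schwarz[of g v] by linarith
  then have "\<gamma> * F \<le> \<gamma> * (norm g * norm v - \<gamma> / 2 * (norm v)\<^sup>2)"
    using \<open>\<gamma> \<ge> 0\<close> by (rule mult_left_mono)
  moreover have "0 \<le> (norm g - \<gamma> / 2 * norm v)\<^sup>2"
    by simp
  ultimately show ?thesis
    by (simp add: power2_eq_square algebra_simps)
qed

theorem theorem5:
  fixes m :: nat
    and fs :: "nat \<Rightarrow> real ^ 'n::finite \<Rightarrow> real"
    and f :: "real ^ 'n \<Rightarrow> real"
    and L :: "nat \<Rightarrow> real"
    and P :: "real ^ 'n \<Rightarrow> real ^ 'n"
    and \<gamma> \<alpha> :: real
    and x :: "real ^ 'n"
  assumes "m \<ge> 1"
    and differentiable: "\<And>i. i \<in> {1..m} \<Longrightarrow> fs i differentiable_on UNIV"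
    and f_eq: "f = (\<lambda>x. \<Sum>i=1..m. fs i x)"
    and nonneg: "\<And>i x. i \<in> {1..m} \<Longrightarrow> fs i x \<ge> 0"
    and lipschitz: "\<And>i x z. i \<in> {1..m} \<Longrightarrow>
      norm (grad (fs i) x - grad (fs i) z) \<le> L i * norm (x - z)"
    and proj: "is_projection (global_minimizers f) P"
    and "\<gamma> > 0"
    and growth: "\<And>x. f x - f (P x) \<le> grad f x \<bullet> (x - P x) - \<gamma> / 2 * (norm (P x - x))\<^sup>2"
    and min_zero: "\<exists>x \<in> global_minimizers f. f x = 0"
    and "0 < \<alpha>"
    and "\<alpha> \<le> \<gamma>\<^sup>2 / (2 * (\<Sum>l=1..m. L l) * (\<Sum>i=1..m. (L i)\<^sup>2))"
  shows "measure_pmf.expectation (doubly_stochastic_step m fs \<alpha> x) f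
    \<le> (1 - \<alpha> * \<gamma> / (real m * real CARD('n))) * f x"
proof -
  define M where "M = (\<Sum>i=1..m. L i)"
  define Q where "Q = (\<Sum>i=1..m. (L i)\<^sup>2)"
  define N where "N = (\<Sum>i=1..m. (norm (grad (fs i) x))\<^sup>2)"
  define d where "d = norm (x - P x)"
  have G: "GDERIV (fs i) y :> grad (fs i) y" if "i \<in> {1..m}" for i y
    using differentiable[OF that] by (intro gderiv_grad) (simp add: differentiable_on_def)
  have "GDERIV f y :> (\<Sum>i=1..m. grad (fs i) y)" for y
    unfolding f_eq by (intro gderiv_sum G)
  then have grad_f: "grad f y = (\<Sum>i=1..m. grad (fs i) y)" for y
    by (intro gderiv_unique[OF gderiv_grad]) (auto simp: gderiv_def differentiable_def)
  have f_Px: "f (P x) = 0"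
  proof -
    have "P x \<in> global_minimizers f"
      using proj by (auto simp: is_projection_def is_arg_min_def)
    moreover obtain y where "f y = 0"
      using min_zero by blast
    ultimately have "f (P x) \<le> 0"
      unfolding global_minimizers_def mem_Collect_eq by metis
    moreover have "f (P x) \<ge> 0"
      unfolding f_eq by (intro sum_nonneg nonneg)
    ultimately show ?thesis by simp
  qed
  have component_bound: "norm (grad (fs i) x) \<le> L i * d" if i: "i \<in> {1..m}" for i
  proof -
    have "fs i (P x) = 0"
      using f_Px i nonneg unfolding f_eq by (subst (asm) sum_nonneg_eq_0_iff) auto
    then have "grad (fs i) (P x) = 0"
      using nonneg[OF i] by (intro gderiv_zero_at_minimum[OF G[OF i]]) simp
    then show ?thesis
      using lipschitz[OF i, of x "P x"] by (simp add: d_def)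
  qed
  have N_le: "N \<le> Q * d\<^sup>2"
    unfolding N_def Q_def sum_distrib_right power_mult_distrib[symmetric]
    by (intro sum_mono power_mono component_bound) auto
  have "L i \<ge> 0" if "i \<in> {1..m}" for i
  proof -
    have "0 \<le> L i * norm (axis undefined 1 - 0 :: real ^ 'n)"
      using lipschitz[OF that] norm_ge_zero order_trans by blast
    then show ?thesis by simp
  qed
  then have "M \<ge> 0" and "Q \<ge> 0"
    unfolding M_def Q_def by (auto intro: sum_nonneg)
  have alpha: "\<alpha> \<le> \<gamma>\<^sup>2 / (2 * M * Q)"
    using assms(11) by (simp add: M_def Q_def)
  \<comment> \<open>If all \<open>L i\<close> were zero, the bound on \<open>\<alpha>\<close> would be a division by zero, hence \<open>\<alpha> \<le> 0\<close>.\<close>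
  then have "M * Q \<noteq> 0"
    using \<open>0 < \<alpha>\<close> by auto
  then have "M * Q > 0"
    using \<open>M \<ge> 0\<close> \<open>Q \<ge> 0\<close> by (simp add: order_less_le)
  then have alpha': "\<alpha> * (M * Q) \<le> \<gamma>\<^sup>2 / 2"
    using alpha by (simp add: field_simps)
  have "M * \<alpha>\<^sup>2 / 2 * N \<le> M * \<alpha>\<^sup>2 / 2 * (Q * d\<^sup>2)"
    using N_le \<open>M \<ge> 0\<close> by (intro mult_left_mono) auto
  also have "\<dots> = \<alpha> * (d\<^sup>2 / 2 * (\<alpha> * (M * Q)))"
    by (simp add: power2_eq_square)
  also have "\<dots> \<le> \<alpha> * (d\<^sup>2 / 2 * (\<gamma>\<^sup>2 / 2))"
    using alpha' \<open>0 < \<alpha>\<close> by (intro mult_left_mono) auto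
  also have "\<dots> = \<alpha> * (\<gamma> / 2 * d)\<^sup>2"
    by (simp add: power2_eq_square)
  finally have noise: "M * \<alpha>\<^sup>2 / 2 * N \<le> \<alpha> * (\<gamma> / 2 * d)\<^sup>2" .
  have "\<gamma> * f x \<le> (norm (grad f x))\<^sup>2 - (\<gamma> / 2 * d)\<^sup>2"
    using growth[of x] \<open>\<gamma> > 0\<close> unfolding d_def
    by (intro growth_imp_gradient_bound) (auto simp: f_Px norm_minus_commute)
  then have "\<alpha> * (\<gamma> * f x) \<le> \<alpha> * ((norm (grad f x))\<^sup>2 - (\<gamma> / 2 * d)\<^sup>2)"
    using \<open>0 < \<alpha>\<close> by (intro mult_left_mono) auto
  with noise have "\<alpha> * \<gamma> * f x \<le> \<alpha> * (norm (grad f x))\<^sup>2 - M * \<alpha>\<^sup>2 / 2 * N"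
    by (simp add: algebra_simps)
  then have "\<alpha> * \<gamma> * f x / (real m * real CARD('n))
      \<le> (\<alpha> * (norm (grad f x))\<^sup>2 - M * \<alpha>\<^sup>2 / 2 * N) / (real m * real CARD('n))"
    by (rule divide_right_mono) simp
  moreover have "measure_pmf.expectation (doubly_stochastic_step m fs \<alpha> x) f
      \<le> f x - (\<alpha> * (norm (grad f x))\<^sup>2 - M * \<alpha>\<^sup>2 / 2 * N) / (real m * real CARD('n))"
    unfolding grad_f M_def N_def unfolding f_eq
    by (intro expected_decrease \<open>m \<ge> 1\<close> G lipschitz)
  ultimately show ?thesis
    by (simp add: algebra_simps)
qed

end
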